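(* Let $\Omega\subseteq\mathbb{R}^N$ be a bounded domain with $C^2$ boundary. If $\Omega$ is strongly convex then $\Omega$ is geometrically convex.
   Context: A domain is a connected open set. $\Omega$ is geometrically convex if for all $P,Q\in\Omega$ the closed segment $\{(1-t)P+tQ:0\le t\le 1\}$ lies in $\Omega$. A $C^k$ function $\rho:\mathbb{R}^N\to\mathbb{R}$ is a $C^k$ defining function for $\Omega$ if $\Omega=\{x:\rho(x)<0\}$, the complement of $\overline{\Omega}$ equals $\{x:\rho(x)>0\}$, and $\nabla\rho(x)\neq 0$ for all $x\in\partial\Omega$. The domain has $C^k$ boundary if it has a $C^k$ defining function. For $P\in\partial\Omega$, $T_P(\partial\Omega)=\{w\in\mathbb{R}^N:\sum_{j=1}^N \frac{\partial\rho}{\partial x_j}(P)w_j=0\}$. A bounded domain $\Omega$ with $C^2$ boundary and $C^2$ defining function $\rho$ is strongly convex if for every $P\in\partial\Omega$ one has $\sum_{j,k=1}^N\frac{\partial^2\rho}{\partial x_j\partial x_k}(P)w_jw_k> 0$ for all nonzero $w\in T_P(\partial\Omega)$ (this does not depend on the choice of $C^2$ defining function). *)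

theory Defs
  imports "HOL-Analysis.Analysis"
begin

definition partial_deriv :: "'n::finite \<Rightarrow> (real ^ 'n \<Rightarrow> real) \<Rightarrow> real ^ 'n \<Rightarrow> real" where
  "partial_deriv j f x = deriv (\<lambda>t. f (x + t *\<^sub>R axis j 1)) 0"

definition partially_differentiable :: "'n::finite \<Rightarrow> (real ^ 'n \<Rightarrow> real) \<Rightarrow> real ^ 'n \<Rightarrow> bool" where
  "partially_differentiable j f x \<longleftrightarrow> (\<lambda>t. f (x + t *\<^sub>R axis j 1)) field_differentiable (at 0)"

text \<open>\<open>Ck k f\<close>: all partial derivatives of \<open>f\<close> of order at most \<open>k\<close> exist and are
  continuous on the whole space.\<close>

fun Ck :: "nat \<Rightarrow> (real ^ 'n::finite \<Rightarrow> real) \<Rightarrow> bool" where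
  "Ck 0 f \<longleftrightarrow> continuous_on UNIV f"
| "Ck (Suc k) f \<longleftrightarrow>
     continuous_on UNIV f \<and>
     (\<forall>j. (\<forall>x. partially_differentiable j f x) \<and> Ck k (partial_deriv j f))"

definition gradient :: "(real ^ 'n::finite \<Rightarrow> real) \<Rightarrow> real ^ 'n \<Rightarrow> real ^ 'n" where
  "gradient f x = (\<chi> j. partial_deriv j f x)"

definition Ck_defining_function ::
    "nat \<Rightarrow> (real ^ 'n::finite \<Rightarrow> real) \<Rightarrow> (real ^ 'n) set \<Rightarrow> bool" where
  "Ck_defining_function k \<rho> \<Omega> \<longleftrightarrow>
     Ck k \<rho> \<and> \<Omega> = {x. \<rho> x < 0} \<and> - closure \<Omega> = {x. \<rho> x > 0} \<and>
     (\<forall>x\<in>frontier \<Omega>. gradient \<rho> x \<noteq> 0)"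

definition has_Ck_boundary :: "nat \<Rightarrow> (real ^ 'n::finite) set \<Rightarrow> bool" where
  "has_Ck_boundary k \<Omega> \<longleftrightarrow> (\<exists>\<rho>. Ck_defining_function k \<rho> \<Omega>)"

text \<open>The tangent space at a boundary point, computed from a defining function.\<close>

definition tangent_space :: "(real ^ 'n::finite \<Rightarrow> real) \<Rightarrow> real ^ 'n \<Rightarrow> (real ^ 'n) set" where
  "tangent_space \<rho> P = {w. (\<Sum>j\<in>UNIV. partial_deriv j \<rho> P * w $ j) = 0}"

text \<open>The condition does not depend on the choice of the defining function, so it is
  imposed on some \<open>C\<^sup>2\<close> defining function. The notion is meant for bounded domains;
  openness, connectedness and boundedness are separate hypotheses.\<close>

definition strongly_convex :: "(real ^ 'n::finite) set \<Rightarrow> bool" where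
  "strongly_convex \<Omega> \<longleftrightarrow>
     (\<exists>\<rho>. Ck_defining_function 2 \<rho> \<Omega> \<and>
        (\<forall>P\<in>frontier \<Omega>. \<forall>w\<in>tangent_space \<rho> P. w \<noteq> 0 \<longrightarrow>
           (\<Sum>j\<in>UNIV. \<Sum>k\<in>UNIV. partial_deriv j (partial_deriv k \<rho>) P * w $ j * w $ k) > 0))"

definition geometrically_convex :: "(real ^ 'n::finite) set \<Rightarrow> bool" where
  "geometrically_convex \<Omega> \<longleftrightarrow> (\<forall>P\<in>\<Omega>. \<forall>Q\<in>\<Omega>. closed_segment P Q \<subseteq> \<Omega>)"

lemma geometrically_convex_iff_convex: "geometrically_convex \<Omega> \<longleftrightarrow> convex \<Omega>"
  by (simp add: geometrically_convex_def convex_contains_segment)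

end

theory Submission imports Defs begin

text \<open>Fix a point \<open>P\<close> of the domain and consider the set of points that \<open>P\<close> sees inside the
  domain. It is nonempty and open. If \<open>Q\<close> is a limit of visible points, then \<open>\<rho> \<le> 0\<close> along
  the segment from \<open>P\<close> to \<open>Q\<close>. At a point where the segment meets the boundary, \<open>\<rho>\<close>
  restricted to the segment has a maximum, so the segment is tangent to the boundary there, and
  strong convexity makes the second derivative positive, which is absurd. Hence the set of
  visible points is also relatively closed, and connectedness finishes the proof.\<close>

text \<open>\<open>partial_deriv\<close> only differentiates at parameter 0; moving the base point
  along the axis turns this into a derivative at any parameter \<open>s\<close>, as the mean value
  bound below requires.\<close>

lemma partial_deriv_line:
  assumes "\<And>x. partially_differentiable j f x"
  shows "((\<lambda>t. f (x + t *\<^sub>R axis j 1)) has_field_derivative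
           partial_deriv j f (x + s *\<^sub>R axis j 1)) (at s within S)"
proof -
  let ?y = "x + s *\<^sub>R axis j 1"
  have "((\<lambda>t. f (?y + t *\<^sub>R axis j 1)) has_field_derivative partial_deriv j f ?y) (at 0)"
    using assms[of ?y] unfolding partially_differentiable_def partial_deriv_def
    by (simp add: DERIV_deriv_iff_field_differentiable)
  then have "((\<lambda>t. f (x + (t + s) *\<^sub>R axis j 1)) has_field_derivative partial_deriv j f ?y) (at 0)"
    by (simp add: algebra_simps)
  then have "((\<lambda>t. f (x + t *\<^sub>R axis j 1)) has_field_derivative partial_deriv j f ?y) (at (0 + s))"
    by (subst DERIV_shift)
  then show ?thesis
    by (simp add: has_field_derivative_at_within)
qed

text \<open>The coordinates are moved one at a time. Each newly moved coordinate costs an error that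
  the mean value inequality and the continuity of its partial derivative make small. Summing over a
  finite set \<open>S\<close> instead of all indices makes this an induction, and \<open>e\<close>
  stays arbitrary because each step halves it.\<close>

lemma Ck_1_local_linear_approx:
  fixes f :: "real ^ 'n::finite \<Rightarrow> real"
  assumes "Ck 1 f" and "finite S" and "e > 0"
  shows "\<exists>d>0. \<forall>h. norm h < d \<longrightarrow>
           \<bar>f (x + (\<Sum>j\<in>S. h $ j *\<^sub>R axis j 1)) - f x - (\<Sum>j\<in>S. partial_deriv j f x * h $ j)\<bar>
             \<le> e * norm h"
  using assms(2,3)
proof (induction S arbitrary: e)
  case empty
  then show ?case by (auto intro!: exI[of _ 1])
next
  case (insert j S)
  have pd: "\<And>x. partially_differentiable j f x"
    and cont: "continuous_on UNIV (partial_deriv j f)"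
    using assms(1) by auto
  obtain d1 where d1: "d1 > 0" "\<And>h. norm h < d1 \<Longrightarrow>
      \<bar>f (x + (\<Sum>j\<in>S. h $ j *\<^sub>R axis j 1)) - f x - (\<Sum>j\<in>S. partial_deriv j f x * h $ j)\<bar>
        \<le> e / 2 * norm h"
    using insert.IH[of "e / 2"] insert.prems by auto
  obtain d2 where d2: "d2 > 0" "\<And>y. dist y x < d2 \<Longrightarrow>
      dist (partial_deriv j f y) (partial_deriv j f x) < e / 2"
    using cont insert.prems unfolding continuous_on_iff by (metis UNIV_I half_gt_zero)
  show ?case
  proof (intro exI[of _ "min d1 d2"] conjI allI impI)
    show "min d1 d2 > 0" using d1 d2 by simp
    fix h :: "real ^ 'n"
    assume h: "norm h < min d1 d2"
    define y where "y = (\<Sum>j\<in>S. h $ j *\<^sub>R axis j (1::real))"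
    \<comment> \<open>With the linear term at \<open>x\<close> subtracted, the derivative of
      \<open>g\<close> is the deviation of the partial derivative from its value at
      \<open>x\<close>, which is small near \<open>x\<close>.\<close>
    define g where "g s = f ((x + y) + s *\<^sub>R axis j 1) - partial_deriv j f x * s" for s
    have y_nth: "y $ i = (if i \<in> S then h $ i else 0)" for i
      using insert.hyps by (simp add: y_def axis_def if_distrib[of "(*) _"] cong: if_cong)
    have "norm (g (h $ j) - g 0) \<le> e / 2 * norm (h $ j - 0)"
    proof (rule field_differentiable_bound)
      show "convex (closed_segment 0 (h $ j))" by simp
    next
      fix s assume s: "s \<in> closed_segment 0 (h $ j)"
      show "(g has_field_derivative
          (partial_deriv j f ((x + y) + s *\<^sub>R axis j 1) - partial_deriv j f x))
          (at s within closed_segment 0 (h $ j))"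
        unfolding g_def by (rule DERIV_diff partial_deriv_line pd DERIV_cmult_Id)+
      have "\<bar>s\<bar> \<le> \<bar>h $ j\<bar>"
        using s by (auto simp: closed_segment_eq_real_ivl split: if_splits)
      \<comment> \<open>Since \<open>j\<close> is not in \<open>S\<close>, the vector
        \<open>y\<close> has no \<open>j\<close>-component, so each component of the sum is bounded
        by that of \<open>h\<close>.\<close>
      then have "norm (y + s *\<^sub>R axis j 1) \<le> norm h"
        using insert.hyps
        by (intro norm_le_componentwise_cart) (auto simp: y_nth axis_def)
      then have "dist ((x + y) + s *\<^sub>R axis j 1) x < d2"
        using h by (simp add: dist_norm algebra_simps)
      from d2(2)[OF this]
      show "norm (partial_deriv j f ((x + y) + s *\<^sub>R axis j 1) - partial_deriv j f x) \<le> e / 2"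
        by (simp add: dist_norm)
    qed auto
    also have "\<dots> \<le> e / 2 * norm h"
      using insert.prems component_le_norm_cart[of h j] by (simp add: mult_left_mono)
    finally have 1: "\<bar>g (h $ j) - g 0\<bar> \<le> e / 2 * norm h" by simp
    have 2: "\<bar>f (x + y) - f x - (\<Sum>j\<in>S. partial_deriv j f x * h $ j)\<bar> \<le> e / 2 * norm h"
      using d1(2)[of h] h by (simp add: y_def)
    have "x + (\<Sum>j\<in>insert j S. h $ j *\<^sub>R axis j (1::real)) = (x + y) + h $ j *\<^sub>R axis j 1"
      using insert.hyps by (simp add: y_def ac_simps)
    moreover have "(\<Sum>j\<in>insert j S. partial_deriv j f x * h $ j)
        = partial_deriv j f x * h $ j + (\<Sum>j\<in>S. partial_deriv j f x * h $ j)"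
      using insert.hyps by simp
    ultimately have "f (x + (\<Sum>j\<in>insert j S. h $ j *\<^sub>R axis j 1)) - f x
          - (\<Sum>j\<in>insert j S. partial_deriv j f x * h $ j)
        = (g (h $ j) - g 0) + (f (x + y) - f x - (\<Sum>j\<in>S. partial_deriv j f x * h $ j))"
      by (simp only: g_def) simp
    then show "\<bar>f (x + (\<Sum>j\<in>insert j S. h $ j *\<^sub>R axis j 1)) - f x
          - (\<Sum>j\<in>insert j S. partial_deriv j f x * h $ j)\<bar> \<le> e * norm h"
      using 1 2 by linarith
  qed
qed

text \<open>This is the approximation above with all coordinates moved, where the sum over the axes
  recovers \<open>h\<close>.\<close>

lemma Ck_1_has_derivative:
  fixes f :: "real ^ 'n::finite \<Rightarrow> real"
  assumes "Ck 1 f"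
  shows "(f has_derivative (\<lambda>h. \<Sum>j\<in>UNIV. partial_deriv j f x * h $ j)) (at x)"
  unfolding has_derivative_at_alt
proof (intro conjI allI impI)
  show "bounded_linear (\<lambda>h. \<Sum>j\<in>UNIV. partial_deriv j f x * h $ j)"
    by (intro bounded_linear_sum bounded_linear_const_mult bounded_linear_vec_nth)
next
  fix e :: real
  assume "e > 0"
  have "(\<Sum>j\<in>UNIV. h $ j *\<^sub>R axis j 1) = h" for h :: "real ^ 'n"
    using basis_expansion[of h] by (simp add: scalar_mult_eq_scaleR)
  then obtain d where d: "d > 0" "\<And>h. norm h < d \<Longrightarrow>
      \<bar>f (x + h) - f x - (\<Sum>j\<in>UNIV. partial_deriv j f x * h $ j)\<bar> \<le> e * norm h"
    using Ck_1_local_linear_approx[OF assms finite \<open>e > 0\<close>, where x = x and S = UNIV] by auto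
  have "norm (f y - f x - (\<Sum>j\<in>UNIV. partial_deriv j f x * (y - x) $ j)) \<le> e * norm (y - x)"
    if "norm (y - x) < d" for y
    using d(2)[OF that] by simp
  then show "\<exists>d>0. \<forall>y. norm (y - x) < d \<longrightarrow>
      norm (f y - f x - (\<Sum>j\<in>UNIV. partial_deriv j f x * (y - x) $ j)) \<le> e * norm (y - x)"
    using d(1) by blast
qed

text \<open>Chain rule along a line. Applied to a defining function and then to its partial
  derivatives, it yields the gradient pairing and the Hessian form in direction
  \<open>w\<close>.\<close>

lemma Ck_1_line_DERIV:
  fixes f :: "real ^ 'n::finite \<Rightarrow> real"
  assumes "Ck 1 f"
  shows "((\<lambda>t. f (p + t *\<^sub>R w)) has_real_derivative
           (\<Sum>j\<in>UNIV. partial_deriv j f (p + t *\<^sub>R w) * w $ j)) (at t)"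
proof -
  have "((\<lambda>t. p + t *\<^sub>R w) has_derivative (\<lambda>h. h *\<^sub>R w)) (at t)"
    by (auto intro!: derivative_eq_intros)
  from diff_chain_at[OF this Ck_1_has_derivative[OF assms]]
  show ?thesis
    unfolding o_def by (rule has_derivative_imp_has_field_derivative)
      (simp add: sum_distrib_left mult_ac)
qed

text \<open>As \<open>f'\<close> vanishes at \<open>t0\<close> with positive slope, it is positive
  just to the right, and by the mean value theorem \<open>f\<close> exceeds \<open>f t0\<close>
  there, within any prescribed distance \<open>d\<close>.\<close>

lemma second_derivative_pos_not_local_max:
  fixes f :: "real \<Rightarrow> real"
  assumes f: "\<And>t. (f has_real_derivative f' t) (at t)"
    and f': "(f' has_real_derivative D) (at t0)"
    and "f' t0 = 0" and "D > 0" and "d > 0"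
  shows "\<exists>t. \<bar>t - t0\<bar> < d \<and> f t > f t0"
proof -
  obtain e where e: "e > 0" "\<And>h. 0 < h \<Longrightarrow> h < e \<Longrightarrow> f' t0 < f' (t0 + h)"
    using DERIV_pos_inc_right[OF f' \<open>D > 0\<close>] by blast
  define h where "h = min d e / 2"
  have h: "0 < h" "h < d" "h < e"
    using \<open>d > 0\<close> e(1) by (auto simp: h_def)
  obtain z where z: "t0 < z" "z < t0 + h" "f (t0 + h) - f t0 = (t0 + h - t0) * f' z"
    using MVT2[of t0 "t0 + h" f f'] f h by auto
  have "h * f' z > 0"
    using e(2)[of "z - t0"] z h \<open>f' t0 = 0\<close> by simp
  then have "f (t0 + h) > f t0" using z(3) by simp
  then show ?thesis using h by (intro exI[of _ "t0 + h"]) simp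
qed

theorem proposition5:
  fixes \<Omega> :: "(real ^ 'n::finite) set"
  assumes "open \<Omega>" and "connected \<Omega>" and "bounded \<Omega>"
    and "has_Ck_boundary 2 \<Omega>"
    and "strongly_convex \<Omega>"
  shows "geometrically_convex \<Omega>"
  unfolding geometrically_convex_def
proof (intro ballI)
  fix P Q
  assume P: "P \<in> \<Omega>" and Q: "Q \<in> \<Omega>"
  obtain \<rho> where \<rho>: "Ck_defining_function 2 \<rho> \<Omega>"
    and pos: "\<And>x w. x \<in> frontier \<Omega> \<Longrightarrow> w \<in> tangent_space \<rho> x \<Longrightarrow> w \<noteq> 0 \<Longrightarrow>
      (\<Sum>j\<in>UNIV. \<Sum>k\<in>UNIV. partial_deriv j (partial_deriv k \<rho>) x * w $ j * w $ k) > 0"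
    using assms(5) unfolding strongly_convex_def by blast
  have neg: "x \<in> \<Omega> \<longleftrightarrow> \<rho> x < 0" and cl: "x \<in> closure \<Omega> \<longleftrightarrow> \<rho> x \<le> 0" for x
    using \<rho> unfolding Ck_defining_function_def by (auto simp: set_eq_iff not_less[symmetric])
  have C1: "Ck 1 \<rho>" "Ck 1 (partial_deriv k \<rho>)" for k
    using \<rho> by (auto simp: Ck_defining_function_def numeral_2_eq_2)
  define V where "V = {R \<in> \<Omega>. closed_segment P R \<subseteq> \<Omega>}"
  have "openin (top_of_set \<Omega>) V"
  proof -
    have "\<exists>e>0. ball R e \<subseteq> V" if "R \<in> V" for R
    proof -
      have "closed_segment P R \<subseteq> \<Omega>" using that by (simp add: V_def)
      \<comment> \<open>Compactness of the segment gives a tube of uniform radius inside the domain.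
        When \<open>R\<close> moves by less than \<open>e\<close>, points with equal parameter
        \<open>t\<close> move no further, so the new segment stays in the tube.\<close>
      then obtain e where e: "e > 0" "(\<Union>x\<in>closed_segment P R. ball x e) \<subseteq> \<Omega>"
        using compact_subset_open_imp_ball_epsilon_subset[OF compact_segment assms(1)] by metis
      have "ball R e \<subseteq> V"
      proof
        fix S assume S: "S \<in> ball R e"
        have "closed_segment P S \<subseteq> \<Omega>"
        proof
          fix x assume "x \<in> closed_segment P S"
          then obtain t where t: "0 \<le> t" "t \<le> 1" "x = (1 - t) *\<^sub>R P + t *\<^sub>R S"
            by (auto simp: closed_segment_def)
          let ?y = "(1 - t) *\<^sub>R P + t *\<^sub>R R"
          have "dist ?y x = t * dist R S"
            using t by (simp add: dist_norm flip: scaleR_diff_right)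
          also have "\<dots> \<le> dist R S" using t by (simp add: mult_left_le_one_le)
          finally have "x \<in> ball ?y e" using S by simp
          moreover have "?y \<in> closed_segment P R" using t by (auto simp: closed_segment_def)
          ultimately show "x \<in> \<Omega>" using e by blast
        qed
        then show "S \<in> V" by (auto simp: V_def)
      qed
      then show ?thesis using e by blast
    qed
    then have "open V" by (simp add: open_contains_ball)
    then show ?thesis by (auto simp: V_def intro: open_subset)
  qed
  moreover have "closedin (top_of_set \<Omega>) V"
    unfolding closedin_limpt
  proof (intro conjI allI impI)
    show "V \<subseteq> \<Omega>" by (auto simp: V_def)
    fix R assume "R islimpt V \<and> R \<in> \<Omega>"
    then have R: "R \<in> \<Omega>" and "R islimpt V" by auto
    then obtain q where q: "\<And>n. q n \<in> V" "q \<longlonglongrightarrow> R"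
      by (auto simp: islimpt_sequential)
    define w where "w = R - P"
    \<comment> \<open>The segments to \<open>q n\<close> converge pointwise; only the weak
      inequality survives the limit, which is why contact with the boundary must be excluded
      next.\<close>
    have le: "\<rho> (P + t *\<^sub>R w) \<le> 0" if "0 \<le> t" "t \<le> 1" for t
    proof -
      have "(1 - t) *\<^sub>R P + t *\<^sub>R q n \<in> closure \<Omega>" for n
        using q(1)[of n] that closure_subset[of \<Omega>] by (auto simp: V_def closed_segment_def)
      moreover have "(\<lambda>n. (1 - t) *\<^sub>R P + t *\<^sub>R q n) \<longlonglongrightarrow> (1 - t) *\<^sub>R P + t *\<^sub>R R"
        by (intro tendsto_intros q)
      ultimately have "(1 - t) *\<^sub>R P + t *\<^sub>R R \<in> closure \<Omega>"
        by (meson closed_closure closed_sequentially)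
      moreover have "(1 - t) *\<^sub>R P + t *\<^sub>R R = P + t *\<^sub>R w"
        by (simp add: w_def algebra_simps)
      ultimately show ?thesis by (simp add: cl)
    qed
    have "P + t0 *\<^sub>R w \<in> \<Omega>" if t0: "0 \<le> t0" "t0 \<le> 1" for t0
    proof (rule ccontr)
      assume out: "P + t0 *\<^sub>R w \<notin> \<Omega>"
      have zero: "\<rho> (P + t0 *\<^sub>R w) = 0" using out le[OF t0] neg by force
      \<comment> \<open>Both endpoints lie in the domain, so a contact point is interior to a
        nondegenerate segment. This leaves a two-sided window of radius \<open>d\<close> around
        \<open>t0\<close>.\<close>
      have "t0 \<noteq> 0" "t0 \<noteq> 1" "w \<noteq> 0" using out P R by (auto simp: w_def)
      define d where "d = min t0 (1 - t0)"
      have d: "d > 0" using t0 \<open>t0 \<noteq> 0\<close> \<open>t0 \<noteq> 1\<close> by (auto simp: d_def)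
      define f where "f t = \<rho> (P + t *\<^sub>R w)" for t
      define f' where "f' t = (\<Sum>k\<in>UNIV. partial_deriv k \<rho> (P + t *\<^sub>R w) * w $ k)" for t
      \<comment> \<open>Grouped by \<open>k\<close>, this is the derivative of \<open>f'\<close>
        term by term: each inner sum differentiates the \<open>k\<close>-th partial derivative along
        the line.\<close>
      define D where "D = (\<Sum>k\<in>UNIV. (\<Sum>j\<in>UNIV.
        partial_deriv j (partial_deriv k \<rho>) (P + t0 *\<^sub>R w) * w $ j) * w $ k)"
      have f: "(f has_real_derivative f' t) (at t)" for t
        unfolding f_def f'_def by (rule Ck_1_line_DERIV[OF C1(1)])
      have f': "(f' has_real_derivative D) (at t0)"
        unfolding f'_def D_def by (intro DERIV_sum DERIV_cmult_right Ck_1_line_DERIV C1)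
      have max: "f t \<le> f t0" if "\<bar>t - t0\<bar> < d" for t
        using le[of t] that zero by (auto simp: f_def d_def)
      have "f' t0 = 0"
        using DERIV_local_max[OF f d, of t0] max by (simp add: abs_minus_commute)
      then have "w \<in> tangent_space \<rho> (P + t0 *\<^sub>R w)"
        by (simp add: tangent_space_def f'_def)
      \<comment> \<open>The value 0 of \<open>\<rho>\<close> puts the point in the closure, while an
        open set is its own interior and misses it.\<close>
      moreover have "P + t0 *\<^sub>R w \<in> frontier \<Omega>"
        using out zero assms(1) by (simp add: frontier_def cl interior_open)
      ultimately have "0 < (\<Sum>j\<in>UNIV. \<Sum>k\<in>UNIV.
          partial_deriv j (partial_deriv k \<rho>) (P + t0 *\<^sub>R w) * w $ j * w $ k)"
        using pos \<open>w \<noteq> 0\<close> by blast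
      also have "\<dots> = D"
        unfolding D_def sum_distrib_right by (rule sum.swap)
      finally have "D > 0" .
      from second_derivative_pos_not_local_max[OF f f' \<open>f' t0 = 0\<close> this d] max
      show False by force
    qed
    moreover have "(1 - t) *\<^sub>R P + t *\<^sub>R R = P + t *\<^sub>R w" for t
      by (simp add: w_def algebra_simps)
    ultimately have "closed_segment P R \<subseteq> \<Omega>"
      by (auto simp: closed_segment_def)
    then show "R \<in> V" using R by (simp add: V_def)
  qed
  moreover have "P \<in> V" using P by (simp add: V_def)
  ultimately have "V = \<Omega>"
    using assms(2) unfolding connected_clopen by blast
  then show "closed_segment P Q \<subseteq> \<Omega>" using Q by (auto simp: V_def)
qed

end
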